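(* Let $n\geq 2$, $D>0$, and let $K\subseteq H^n$ be a set with $\mathrm{diam}_{H^n}K=D$. Then $K$ is complete if and only if $K$ is compact and convex and the distance between any two parallel supporting horospheres of $K$ is $D$, i.e. $w_i(K)=D$ for every ideal point $i$ of $H^n$.
   Context: $H^n$ is hyperbolic $n$-space (curvature $-1$) with geodesic distance $d$. A set is convex if it contains the geodesic segment between any two of its points. The diameter of a bounded set is the supremum of the distances between its points. A bounded set $X\subset H^n$ is complete if for every $z\notin X$ the diameter of $X\cup\{z\}$ is larger than the diameter of $X$. Hyperboloid model: fix a unit vector $e\in\mathbb{R}^{n+1}$ and put $\mathcal{B}(x_0+te,y_0+se)=ts-\langle x_0,y_0\rangle$ for $x_0,y_0\in e^\bot$, $t,s\in\mathbb{R}$; then $H^n=\{x+te: x\in e^\bot,\ t\geq 1,\ t^2-\langle x,x\rangle=1\}$ and $\cosh d(x,y)=\mathcal{B}(x,y)$. An ideal point $i$ is represented by $\mathrm{lin}\,w$ where $w\in\mathbb{R}^{n+1}$, $\mathcal{B}(w,w)=0$, $\mathcal{B}(w,e)>0$. A horoball at $i$ is a set $A=\{z\in H^n:\mathcal{B}(z,w)\leq s\}$ with $s>0$, and its boundary $\partial A=\{z\in H^n:\mathcal{B}(z,w)=s\}$ is a horosphere at $i$. Horospheres at the same ideal point are called parallel. If $A_0=\{\mathcal{B}(z,w)\leq r\}\subset A=\{\mathcal{B}(z,w)\leq s\}$ with $0<r\leq s$, the distance of the parallel horospheres $\partial A,\partial A_0$ is $w(A\setminus \mathrm{int} A_0)=\ln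 (s/r)$; it is the distance between $\ell\cap\partial A$ and $\ell\cap \partial A_0$ for any hyperbolic line $\ell$ having $i$ as an ideal point. For a bounded set $X\subset H^n$ and an ideal point $i$, the horospherical width is $w_i(X)=\min\{w(A\setminus\mathrm{int}A_0)\}$ over all horoballs $A_0\subset A$ at $i$ such that $X\subset A\setminus \mathrm{int}A_0$. For compact $X$ the minimum is attained by the pair of parallel supporting horospheres at $i$: the boundaries of the minimal horoball at $i$ containing $X$ and of the maximal horoball at $i$ whose interior is disjoint from $X$. *)

theory Defs
  imports "HOL-Analysis.Analysis"
begin

text \<open>
  Hyperboloid model of \<open>H\<^sup>n\<close> inside an \<open>(n+1)\<close>-dimensional Euclidean space \<open>'a\<close>, with respect
  to a unit vector \<open>e\<close>.  Throughout, \<open>x \<bullet> e\<close> is the \<open>e\<close>-coordinate \<open>t\<close> of \<open>x = x\<^sub>0 + t e\<close> and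
  \<open>x - (x \<bullet> e) *\<^sub>R e\<close> is its component \<open>x\<^sub>0\<close> orthogonal to \<open>e\<close>.  All definitions are meant
  for \<open>norm e = 1\<close>.
\<close>

definition hyp_form :: "'a::euclidean_space \<Rightarrow> 'a \<Rightarrow> 'a \<Rightarrow> real" where
  "hyp_form e x y =
     (x \<bullet> e) * (y \<bullet> e) - (x - (x \<bullet> e) *\<^sub>R e) \<bullet> (y - (y \<bullet> e) *\<^sub>R e)"

definition hyp_space :: "'a::euclidean_space \<Rightarrow> 'a set" where
  "hyp_space e = {x + t *\<^sub>R e | x t. x \<bullet> e = 0 \<and> t \<ge> 1 \<and> t\<^sup>2 - x \<bullet> x = 1}"

text \<open>On the hyperboloid the form takes values \<open>\<ge> 1\<close>, so \<open>arcosh\<close> gives the solution \<open>d \<ge> 0\<close> of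
  \<open>cosh d = hyp_form e x y\<close>.  The value 0 off the hyperboloid is immaterial; it is needed because
  the locale \<open>Metric_space\<close> asks for nonnegativity of the distance on the whole type.\<close>

definition hyp_dist :: "'a::euclidean_space \<Rightarrow> 'a \<Rightarrow> 'a \<Rightarrow> real" where
  "hyp_dist e x y =
     (if x \<in> hyp_space e \<and> y \<in> hyp_space e then arcosh (hyp_form e x y) else 0)"

definition hyp_topology :: "'a::euclidean_space \<Rightarrow> 'a topology" where
  "hyp_topology e = Metric_space.mtopology (hyp_space e) (hyp_dist e)"

definition hyp_bounded :: "'a::euclidean_space \<Rightarrow> 'a set \<Rightarrow> bool" where
  "hyp_bounded e X \<longleftrightarrow> Metric_space.mbounded (hyp_space e) (hyp_dist e) X"

text \<open>Only meaningful for bounded sets; as for \<open>diameter\<close> in the library, the empty set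
  is given diameter 0.\<close>

definition hyp_diam :: "'a::euclidean_space \<Rightarrow> 'a set \<Rightarrow> real" where
  "hyp_diam e X = (if X = {} then 0 else SUP (x, y) \<in> X \<times> X. hyp_dist e x y)"

definition hyp_complete :: "'a::euclidean_space \<Rightarrow> 'a set \<Rightarrow> bool" where
  "hyp_complete e X \<longleftrightarrow> X \<subseteq> hyp_space e \<and> hyp_bounded e X \<and>
     (\<forall>z \<in> hyp_space e - X. hyp_diam e X < hyp_diam e (X \<union> {z}))"

definition hyp_geodesic :: "'a::euclidean_space \<Rightarrow> 'a \<Rightarrow> 'a \<Rightarrow> (real \<Rightarrow> 'a) \<Rightarrow> bool" where
  "hyp_geodesic e x y g \<longleftrightarrow>
     g 0 = x \<and> g (hyp_dist e x y) = y \<and> g ` {0..hyp_dist e x y} \<subseteq> hyp_space e \<and>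
     (\<forall>s \<in> {0..hyp_dist e x y}. \<forall>t \<in> {0..hyp_dist e x y}.
        hyp_dist e (g s) (g t) = \<bar>s - t\<bar>)"

definition hyp_convex :: "'a::euclidean_space \<Rightarrow> 'a set \<Rightarrow> bool" where
  "hyp_convex e X \<longleftrightarrow> X \<subseteq> hyp_space e \<and>
     (\<forall>x \<in> X. \<forall>y \<in> X. \<forall>g. hyp_geodesic e x y g \<longrightarrow> g ` {0..hyp_dist e x y} \<subseteq> X)"

definition isotropic_vector :: "'a::euclidean_space \<Rightarrow> 'a \<Rightarrow> bool" where
  "isotropic_vector e w \<longleftrightarrow> hyp_form e w w = 0 \<and> hyp_form e w e > 0"

definition ideal_points :: "'a::euclidean_space \<Rightarrow> 'a set set" where
  "ideal_points e = {span {w} | w. isotropic_vector e w}"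

definition horoball :: "'a::euclidean_space \<Rightarrow> 'a \<Rightarrow> real \<Rightarrow> 'a set" where
  "horoball e w s = {z \<in> hyp_space e. hyp_form e z w \<le> s}"

text \<open>The pairs \<open>A\<^sub>0 \<subseteq> A\<close> of horoballs at the ideal point \<open>i = span {w}\<close> are the pairs
  \<open>horoball e w r\<close>, \<open>horoball e w s\<close> with \<open>0 < r \<le> s\<close>, and \<open>ln (s / r)\<close>, the distance of their
  boundary horospheres, does not depend on the representative \<open>w\<close> of \<open>i\<close>.  For nonempty bounded
  \<open>X\<close> the infimum is a minimum, attained at the infimum \<open>r\<close> and the supremum \<open>s\<close> of
  \<open>\<lambda>z. hyp_form e z w\<close> on \<open>X\<close>.\<close>

definition horo_width :: "'a::euclidean_space \<Rightarrow> 'a set \<Rightarrow> 'a set \<Rightarrow> real" where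
  "horo_width e i X =
     Inf {ln (s / r) | w r s. isotropic_vector e w \<and> i = span {w} \<and> 0 < r \<and> r \<le> s \<and>
            X \<subseteq> horoball e w s - hyp_topology e interior_of horoball e w r}"

end

theory Submission imports Defs
begin

text \<open>
  Write \<open>B\<close> for the Lorentz form.  Since \<open>cosh d(x, y) = B(x, y)\<close>, a metric ball is the intersection
  of the hyperboloid \<open>H\<close> with a linear half-space, so statements about balls become linear algebra.
  A set \<open>K\<close> of diameter \<open>D > 0\<close> is complete if and only if it is the intersection of all balls of
  radius \<open>D\<close> centred in \<open>K\<close> (\<open>hyp_complete_iff\<close>); such an intersection is compact and convex.
  The function \<open>x \<mapsto> ln B(x, w)\<close> attached to a future null vector \<open>w\<close> is 1-Lipschitz
  (\<open>horofunction_le\<close>), and \<open>horo_width\<close> is its oscillation on \<open>K\<close> (\<open>horo_width_eq\<close>), so no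
  horospherical width exceeds the diameter.

  Let \<open>K\<close> be complete and let \<open>p\<close> maximise \<open>B(\<cdot>, w)\<close> on \<open>K\<close>.  It suffices that the point \<open>q\<close> at
  distance \<open>D\<close> from \<open>p\<close> on the ray from \<open>p\<close> to the ideal point of \<open>w\<close> lies in \<open>K\<close>, because
  \<open>ln B(q, w) = ln B(p, w) - D\<close>.  Let \<open>Q\<close> be the set of points of \<open>K\<close> at distance exactly \<open>D\<close> from
  \<open>p\<close>.  As \<open>p\<close> is maximal under the constraints \<open>B(x, \<cdot>) \<le> cosh D\<close>, a multiplier rule holds: some
  convex combination \<open>m\<close> of points of \<open>Q\<close> has the form \<open>m = \<alpha> p + \<beta> w\<close> with \<open>\<beta> \<ge> 0\<close>
  (\<open>contact_hull_meets_half_plane\<close>); otherwise a separating hyperplane gives a direction in which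
  \<open>p\<close> could be moved inside \<open>K\<close> to increase \<open>B(\<cdot>, w)\<close> (\<open>contact_point_blocks\<close>).  Now
  \<open>B(m, m) \<ge> 1\<close> forces \<open>q = \<kappa> m - (\<kappa> - 1) cosh D p\<close> with \<open>\<kappa> \<ge> 1\<close>, whence for \<open>y \<in> K\<close>
  \<open>B(q, y) = \<kappa> B(m, y) - (\<kappa> - 1) cosh D B(p, y) \<le> \<kappa> cosh D - (\<kappa> - 1) cosh D = cosh D\<close>.
  So \<open>q\<close> is within distance \<open>D\<close> of all of \<open>K\<close> and lies in \<open>K\<close> by completeness
  (\<open>opposite_point_in_complete\<close>).

  Conversely, let \<open>K\<close> be compact and convex with all widths \<open>D\<close>, let \<open>z \<notin> K\<close>, let \<open>p\<close> be the point
  of \<open>K\<close> nearest to \<open>z\<close>, and let \<open>w\<close> represent the ideal endpoint of the ray from \<open>p\<close> through \<open>z\<close>.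
  By convexity \<open>K\<close> lies beyond the hyperplane orthogonal to this ray at \<open>p\<close>, hence does not meet
  the interior of the horoball at \<open>w\<close> through \<open>p\<close>.  So \<open>p\<close> minimises \<open>B(\<cdot>, w)\<close> on \<open>K\<close>, and width \<open>D\<close> yields
  \<open>b \<in> K\<close> with \<open>ln B(b, w) = ln B(p, w) + D = ln B(z, w) + d(p, z) + D\<close>.  The Lipschitz property
  gives \<open>d(b, z) > D\<close> (\<open>constant_width_imp_complete\<close>).
\<close>

section \<open>The Lorentz form and the hyperbolic metric\<close>

locale hyperboloid =
  fixes e :: "'a::euclidean_space"
  assumes norm_e: "norm e = 1"
begin

abbreviation "B \<equiv> hyp_form e"
abbreviation "H \<equiv> hyp_space e"
abbreviation "d \<equiv> hyp_dist e"

lemma e_e [simp]: "e \<bullet> e = 1"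
  using norm_e by (simp add: norm_eq_1)

lemma form_eq: "B x y = 2 * (x \<bullet> e) * (y \<bullet> e) - x \<bullet> y"
  by (simp add: hyp_form_def inner_diff_left inner_diff_right inner_commute algebra_simps)

lemma form_commute: "B x y = B y x"
  by (simp add: form_eq inner_commute)

lemma form_linear:
  "B (x + y) z = B x z + B y z" "B z (x + y) = B z x + B z y"
  "B (x - y) z = B x z - B y z" "B z (x - y) = B z x - B z y"
  "B (c *\<^sub>R x) z = c * B x z" "B z (c *\<^sub>R x) = c * B z x"
  "B (- x) z = - B x z" "B z (- x) = - B z x" "B 0 z = 0" "B z 0 = 0"
  by (simp_all add: form_eq inner_simps algebra_simps)

lemma form_e: "B x e = x \<bullet> e"
  by (simp add: form_eq)

lemma continuous_on_form [continuous_intros]: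
  "continuous_on S f \<Longrightarrow> continuous_on S g \<Longrightarrow> continuous_on S (\<lambda>x. B (f x) (g x))"
  unfolding form_eq by (intro continuous_intros)

text \<open>
  Reversed sign version of Cauchy-Schwarz: for a future timelike and a future causal vector the
  product of the time components dominates that of the space components.
\<close>

lemma form_pos_timelike:
  assumes "B u u > 0" "B w w \<ge> 0" "u \<bullet> e > 0" "w \<bullet> e > 0"
  shows "B u w > 0"
proof -
  define u0 where "u0 = u - (u \<bullet> e) *\<^sub>R e"
  define w0 where "w0 = w - (w \<bullet> e) *\<^sub>R e"
  have "(norm u0)\<^sup>2 < (u \<bullet> e)\<^sup>2" "(norm w0)\<^sup>2 \<le> (w \<bullet> e)\<^sup>2"
    using assms(1,2) unfolding hyp_form_def u0_def w0_def power2_norm_eq_inner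
    by (simp_all add: power2_eq_square)
  then have "norm u0 < u \<bullet> e" "norm w0 \<le> w \<bullet> e"
    using assms(3,4) by (meson less_imp_le power2_less_imp_less power2_le_imp_le)+
  then have "norm u0 * norm w0 < (u \<bullet> e) * (w \<bullet> e)"
    using assms(3,4) by (meson mult_left_mono mult_strict_right_mono norm_ge_zero order_le_less_trans)
  then show ?thesis
    using norm_cauchy_schwarz[of u0 w0] unfolding hyp_form_def u0_def w0_def by linarith
qed

lemma form_nonneg_causal:
  assumes "B u u \<ge> 0" "B w w \<ge> 0" "u \<bullet> e \<ge> 0" "w \<bullet> e \<ge> 0"
  shows "B u w \<ge> 0"
proof -
  define u0 where "u0 = u - (u \<bullet> e) *\<^sub>R e"
  define w0 where "w0 = w - (w \<bullet> e) *\<^sub>R e"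
  have "(norm u0)\<^sup>2 \<le> (u \<bullet> e)\<^sup>2" "(norm w0)\<^sup>2 \<le> (w \<bullet> e)\<^sup>2"
    using assms(1,2) unfolding hyp_form_def u0_def w0_def power2_norm_eq_inner
    by (simp_all add: power2_eq_square)
  then have "norm u0 \<le> u \<bullet> e" "norm w0 \<le> w \<bullet> e"
    using assms(3,4) by (meson power2_le_imp_le)+
  then have "norm u0 * norm w0 \<le> (u \<bullet> e) * (w \<bullet> e)"
    using assms(3,4) by (simp add: mult_mono)
  then show ?thesis
    using norm_cauchy_schwarz[of u0 w0] unfolding hyp_form_def u0_def w0_def by linarith
qed

lemma hyp_space_iff: "x \<in> H \<longleftrightarrow> B x x = 1 \<and> x \<bullet> e > 0"
proof
  assume "x \<in> H"
  then obtain y t where y: "x = y + t *\<^sub>R e" "y \<bullet> e = 0" "t \<ge> 1" "t\<^sup>2 - y \<bullet> y = 1"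
    unfolding hyp_space_def by auto
  then have "x \<bullet> e = t" by (simp add: inner_simps)
  moreover have "x \<bullet> x = y \<bullet> y + t\<^sup>2"
    using y by (simp add: inner_simps inner_commute power2_eq_square)
  ultimately show "B x x = 1 \<and> x \<bullet> e > 0"
    using y by (simp add: form_eq power2_eq_square)
next
  assume x: "B x x = 1 \<and> x \<bullet> e > 0"
  define y where "y = x - (x \<bullet> e) *\<^sub>R e"
  have 1: "(x \<bullet> e)\<^sup>2 - y \<bullet> y = 1"
    using x unfolding hyp_form_def y_def power2_eq_square by simp
  then have "1 \<le> (x \<bullet> e)\<^sup>2"
    using inner_ge_zero[of y] by linarith
  then have "1 \<le> x \<bullet> e"
    using x power2_le_imp_le[of 1 "x \<bullet> e"] by simp
  moreover have "y \<bullet> e = 0" "x = y + (x \<bullet> e) *\<^sub>R e"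
    by (simp_all add: y_def inner_simps)
  ultimately show "x \<in> H"
    unfolding hyp_space_def using 1 by blast
qed

lemma e_in_hyp: "e \<in> H"
  by (simp add: hyp_space_iff form_e)

lemma form_self: "x \<in> H \<Longrightarrow> B x x = 1"
  by (simp add: hyp_space_iff)

text \<open>
  The form has signature \<open>(1, n)\<close>: a nonzero causal vector, oriented to the future, would pair
  positively with the timelike vector \<open>y\<close>.
\<close>

lemma form_neg_orthogonal:
  assumes "y \<in> H" "B u y = 0" "u \<noteq> 0"
  shows "B u u < 0"
proof (rule ccontr)
  assume n: "\<not> B u u < 0"
  consider "u \<bullet> e = 0" | "u \<bullet> e > 0" | "(-u) \<bullet> e > 0" by fastforce
  then show False
  proof cases
    case 1
    then show False using n assms(3) by (simp add: form_eq)
  next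
    case 2
    then show False
      using form_pos_timelike[of y u] n assms by (simp add: hyp_space_iff form_commute[of y u])
  next
    case 3
    then show False
      using form_pos_timelike[of y "-u"] n assms
      by (simp add: hyp_space_iff form_commute[of y u] form_linear)
  qed
qed

lemma form_nonpos_orthogonal: "y \<in> H \<Longrightarrow> B u y = 0 \<Longrightarrow> B u u \<le> 0"
  using form_neg_orthogonal[of y u] form_linear(9)[of u] by (cases "u = 0") (auto simp: less_imp_le)

lemma in_hypI:
  assumes "x \<in> H" "B z z = 1" "B z x > 0"
  shows "z \<in> H"
proof (rule ccontr)
  assume "z \<notin> H"
  then have "z \<bullet> e \<le> 0" using assms by (simp add: hyp_space_iff)
  moreover have "z \<bullet> e \<noteq> 0"
  proof
    assume "z \<bullet> e = 0"
    then have "z \<bullet> z = -1" using assms(2) by (simp add: form_eq)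
    then show False using inner_ge_zero[of z] by linarith
  qed
  ultimately show False
    using form_pos_timelike[of "-z" x] assms by (simp add: hyp_space_iff form_linear)
qed

lemma form_ge_1:
  assumes "x \<in> H" "y \<in> H"
  shows "B x y \<ge> 1"
proof -
  define u where "u = x - B x y *\<^sub>R y"
  have "B u y = 0"
    using assms by (simp add: u_def form_linear form_self)
  moreover have "B u u = 1 - (B x y)\<^sup>2"
    using assms by (simp add: u_def form_linear form_self form_commute[of y x] power2_eq_square)
  moreover have "B u u \<le> 0"
    using assms(2) \<open>B u y = 0\<close> by (rule form_nonpos_orthogonal)
  ultimately have "1 \<le> (B x y)\<^sup>2" by linarith
  moreover have "B x y > 0"
    by (rule form_pos_timelike) (use assms in \<open>simp_all add: hyp_space_iff\<close>)
  ultimately show ?thesis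
    using power2_le_imp_le[of 1 "B x y"] by simp
qed

lemma form_eq_1_imp_eq:
  assumes "x \<in> H" "y \<in> H" "B x y = 1"
  shows "x = y"
proof -
  have "B (x - y) y = 0" "B (x - y) (x - y) = 0"
    using assms by (simp_all add: form_linear form_self form_commute[of y x])
  then show ?thesis
    using form_neg_orthogonal[OF assms(2), of "x - y"] by force
qed

lemma cosh_dist: "x \<in> H \<Longrightarrow> y \<in> H \<Longrightarrow> cosh (d x y) = B x y"
  by (simp add: hyp_dist_def form_ge_1 cosh_arcosh_real)

lemma dist_nonneg: "d x y \<ge> 0"
  by (simp add: hyp_dist_def form_ge_1)

lemma dist_eqI:
  assumes "x \<in> H" "y \<in> H" "B x y = cosh t" "t \<ge> 0"
  shows "d x y = t"
  using assms by (simp add: hyp_dist_def arcosh_cosh_real)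

lemma dist_le_iff:
  assumes "x \<in> H" "y \<in> H" "t \<ge> 0"
  shows "d x y \<le> t \<longleftrightarrow> B x y \<le> cosh t"
  using cosh_real_nonneg_le_iff[OF dist_nonneg assms(3), of x y] cosh_dist[OF assms(1,2)] by simp

text \<open>
  The triangle inequality.  With \<open>U\<close> and \<open>V\<close> the components of \<open>x\<close> and \<open>z\<close> orthogonal to \<open>y\<close>, it is
  the Cauchy-Schwarz inequality for \<open>- B\<close> on the orthogonal complement of \<open>y\<close>, where the form is
  negative definite.
\<close>

lemma form_triangle:
  assumes "x \<in> H" "y \<in> H" "z \<in> H"
  shows "B x z \<le> cosh (d x y + d y z)"
proof -
  define a where "a = d x y"
  define b where "b = d y z"
  have ab: "cosh a = B x y" "cosh b = B y z" "a \<ge> 0" "b \<ge> 0"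
    using assms by (simp_all add: a_def b_def cosh_dist dist_nonneg)
  show ?thesis
  proof (cases "a = 0 \<or> b = 0")
    case True
    then have "x = y \<or> y = z"
      using ab assms form_eq_1_imp_eq by auto
    then show ?thesis
      using ab assms True dist_eqI[of x x 0] dist_eqI[of z z 0]
      by (auto simp: form_self a_def b_def)
  next
    case False
    then have pos: "sinh a * sinh b > 0" using ab by simp
    define U where "U = x - cosh a *\<^sub>R y"
    define V where "V = z - cosh b *\<^sub>R y"
    \<comment> \<open>The Cauchy-Schwarz inequality for \<open>U\<close> and \<open>V\<close> is the semidefiniteness of the form at \<open>P\<close>.\<close>
    define P where "P = sinh b *\<^sub>R U + sinh a *\<^sub>R V"
    have "B U U = 1 - (cosh a)\<^sup>2" "B V V = 1 - (cosh b)\<^sup>2"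
      using assms unfolding U_def V_def ab(1,2)
      by (simp_all add: form_linear form_self form_commute[of y x] form_commute[of z y]
          power2_eq_square)
    then have sq: "B U U = - (sinh a)\<^sup>2" "B V V = - (sinh b)\<^sup>2"
      by (simp_all add: sinh_square_eq)
    have UV: "B U V = B x z - cosh a * cosh b" "B U y = 0" "B V y = 0"
      using assms unfolding U_def V_def ab(1,2)
      by (simp_all add: form_linear form_self form_commute[of z y])
    have PP: "B P P = 2 * (sinh a * sinh b) * (B U V - sinh a * sinh b)"
      by (simp add: P_def form_linear sq form_commute[of V U] power2_eq_square algebra_simps)
    have "B P y = 0" by (simp add: P_def form_linear UV)
    then have "B P P \<le> 0"
      by (rule form_nonpos_orthogonal[OF assms(2)])
    then have "B U V \<le> sinh a * sinh b"
      using pos PP by (smt (verit) mult_pos_pos)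
    then show ?thesis
      using UV(1) by (simp add: cosh_add a_def[symmetric] b_def[symmetric])
  qed
qed

sublocale hyp: Metric_space H d
proof
  show "0 \<le> d x y" for x y by (rule dist_nonneg)
  show "d x y = d y x" for x y by (simp add: hyp_dist_def form_commute[of x y])
  show "d x y = 0 \<longleftrightarrow> x = y" if "x \<in> H" "y \<in> H" for x y
    using that cosh_dist[of x y] form_eq_1_imp_eq[of x y] dist_eqI[of x y 0]
    by (auto simp: form_self)
  show "d x z \<le> d x y + d y z" if "x \<in> H" "y \<in> H" "z \<in> H" for x y z
    using that form_triangle dist_nonneg by (simp add: dist_le_iff)
qed

text \<open>
  The vector \<open>exp (d x y) y - x\<close> is null and points to the future, so it pairs nonnegatively with
  every future causal \<open>w\<close>.  Taking \<open>w\<close> null bounds the variation of horofunctions, and \<open>w = e\<close>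
  bounds that of the time coordinate.
\<close>

lemma form_le_exp_dist:
  assumes "x \<in> H" "y \<in> H" "B w w \<ge> 0" "w \<bullet> e > 0"
  shows "B x w \<le> exp (d x y) * B y w"
proof -
  define N where "N = exp (d x y) *\<^sub>R y - x"
  have c: "2 * B x y = exp (d x y) + exp (- d x y)"
    using cosh_dist[OF assms(1,2)] by (simp add: cosh_def)
  have "B N N = 1 + exp (d x y) * (exp (d x y) - 2 * B x y)"
    using assms by (simp add: N_def form_linear form_self form_commute[of y x] algebra_simps)
  then have N0: "B N N = 0"
    unfolding c by (simp add: exp_minus)
  have "B N y = exp (d x y) - cosh (d x y)"
    using assms by (simp add: N_def form_linear form_self cosh_dist)
  then have "B N y \<ge> 0"
    using dist_nonneg[of x y] by (simp add: cosh_def)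
  moreover have "B y (- N) > 0" if "N \<bullet> e < 0"
    by (rule form_pos_timelike) (use that N0 assms(2) in \<open>simp_all add: hyp_space_iff form_linear\<close>)
  ultimately have "N \<bullet> e \<ge> 0"
    by (force simp: form_linear form_commute[of y N])
  then have "B N w \<ge> 0"
    using form_nonneg_causal N0 assms by simp
  then show ?thesis
    by (simp add: N_def form_linear)
qed

section \<open>The metric topology is the Euclidean one\<close>

lemma dist_sq_eq:
  assumes "x \<in> H" "y \<in> H"
  shows "(dist x y)\<^sup>2 = 2 * (x \<bullet> e - y \<bullet> e)\<^sup>2 + 2 * (B x y - 1)"
  using assms unfolding dist_norm power2_norm_eq_inner
  by (simp add: hyp_space_iff form_eq inner_simps inner_commute power2_eq_square algebra_simps)

text \<open>
  The hyperbolic distance controls the Euclidean one near \<open>x\<close>: the bound tends to 0 with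
  \<open>d x y\<close>.
\<close>

lemma dist_sq_le:
  assumes "x \<in> H" "y \<in> H"
  shows "(dist x y)\<^sup>2 \<le> 2 * ((x \<bullet> e) * (exp (d x y) - 1))\<^sup>2 + 2 * (cosh (d x y) - 1)"
proof -
  define E where "E = exp (d x y)"
  have E: "E \<ge> 1" using dist_nonneg by (simp add: E_def)
  have pos: "x \<bullet> e > 0" "y \<bullet> e > 0" using assms by (simp_all add: hyp_space_iff)
  have "x \<bullet> e \<le> E * (y \<bullet> e)" "y \<bullet> e \<le> E * (x \<bullet> e)"
    using form_le_exp_dist[OF assms, of e] form_le_exp_dist[OF assms(2,1), of e]
    by (simp_all add: form_e E_def hyp.commute)
  then have "y \<bullet> e - x \<bullet> e \<le> (x \<bullet> e) * (E - 1)" "x \<bullet> e - y \<bullet> e \<le> (y \<bullet> e) * (E - 1)"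
    by (simp_all add: algebra_simps)
  moreover have "(y \<bullet> e) * (E - 1) \<le> (x \<bullet> e) * (E - 1)" if "y \<bullet> e \<le> x \<bullet> e"
    using that E by (simp add: mult_right_mono)
  ultimately have "\<bar>x \<bullet> e - y \<bullet> e\<bar> \<le> (x \<bullet> e) * (E - 1)"
    using E pos by (smt (verit) mult_nonneg_nonneg)
  then have "(x \<bullet> e - y \<bullet> e)\<^sup>2 \<le> ((x \<bullet> e) * (E - 1))\<^sup>2"
    using abs_le_square_iff by fastforce
  then show ?thesis
    using assms by (simp add: dist_sq_eq cosh_dist E_def)
qed

lemma hyp_topology_eq: "hyp_topology e = top_of_set H"
proof -
  have nbhd: "(\<exists>r>0. hyp.mball x r \<subseteq> U) \<longleftrightarrow> (\<exists>r>0. \<forall>y\<in>H. dist y x < r \<longrightarrow> y \<in> U)"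
    if x: "x \<in> H" for x U
  proof
    assume "\<exists>r>0. hyp.mball x r \<subseteq> U"
    then obtain r where r: "r > 0" "hyp.mball x r \<subseteq> U" by blast
    have "continuous_on H (\<lambda>y. arcosh (B x y))"
    proof (rule continuous_on_compose2[OF continuous_on_arcosh[OF order_refl]])
      show "continuous_on H (B x)"
        by (rule continuous_on_form[OF continuous_on_const continuous_on_id])
      show "B x ` H \<subseteq> {1..}" using form_ge_1[OF x] by auto
    qed
    then obtain r' where r': "r' > 0"
      "\<And>y. y \<in> H \<Longrightarrow> dist y x < r' \<Longrightarrow> dist (arcosh (B x y)) (arcosh (B x x)) < r"
      using x r(1) unfolding continuous_on_iff by meson
    have "d x y < r" if "y \<in> H" "dist y x < r'" for y
    proof -
      have "arcosh (B x x) = 0" using x by (simp add: form_self)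
      then have "\<bar>d x y\<bar> < r"
        using r'(2)[OF that] x that by (simp add: hyp_dist_def dist_real_def)
      then show ?thesis by simp
    qed
    then show "\<exists>r>0. \<forall>y\<in>H. dist y x < r \<longrightarrow> y \<in> U"
      using r r'(1) x by (intro exI[of _ r']) (auto simp: hyp.mball_def subset_iff)
  next
    assume "\<exists>r>0. \<forall>y\<in>H. dist y x < r \<longrightarrow> y \<in> U"
    then obtain r where r: "r > 0" "\<forall>y\<in>H. dist y x < r \<longrightarrow> y \<in> U" by blast
    define f where "f t = 2 * ((x \<bullet> e) * (exp t - 1))\<^sup>2 + 2 * (cosh t - 1)" for t :: real
    have "continuous_on UNIV f"
      unfolding f_def by (intro continuous_intros)
    moreover have "f 0 = 0" by (simp add: f_def)
    ultimately obtain r' where r': "r' > 0" "\<And>t. dist t 0 < r' \<Longrightarrow> dist (f t) 0 < r\<^sup>2"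
      using r(1) unfolding continuous_on_iff by (metis UNIV_I zero_less_power)
    have "dist y x < r" if "y \<in> H" "d x y < r'" for y
    proof -
      have "f (d x y) < r\<^sup>2"
        using r'(2)[of "d x y"] that by (simp add: dist_real_def)
      then have "(dist y x)\<^sup>2 < r\<^sup>2"
        using dist_sq_le[OF x that(1)] by (simp add: f_def dist_commute)
      then show ?thesis
        using r(1) by (simp add: power2_less_imp_less)
    qed
    then show "\<exists>r>0. hyp.mball x r \<subseteq> U"
      using r r'(1) by (intro exI[of _ r']) (auto simp: hyp.mball_def)
  qed
  have "openin (hyp_topology e) U \<longleftrightarrow> openin (top_of_set H) U" for U
    unfolding hyp_topology_def hyp.openin_mtopology openin_euclidean_subtopology_iff Ball_def
  proof (rule conj_cong[OF refl], intro all_cong1 imp_cong refl)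
    fix x assume "U \<subseteq> H" "x \<in> U"
    then have "x \<in> H" by blast
    from nbhd[OF this] show "(\<exists>r>0. hyp.mball x r \<subseteq> U)
        \<longleftrightarrow> (\<exists>r>0. \<forall>y. y \<in> H \<longrightarrow> dist y x < r \<longrightarrow> y \<in> U)"
      unfolding Ball_def .
  qed
  then show ?thesis by (simp add: topology_eq)
qed

lemma closed_hyp: "closed H"
proof -
  have "x \<bullet> e \<ge> 1" if "x \<in> H" for x
    using form_ge_1[OF that e_in_hyp] by (simp add: form_e)
  then have "H = {x. B x x = 1 \<and> x \<bullet> e \<ge> 1}"
    by (force simp: hyp_space_iff)
  also have "closed \<dots>"
    by (intro closed_Collect_conj closed_Collect_eq closed_Collect_le continuous_intros)
  finally show ?thesis .
qed

lemma compactin_hyp_iff: "compactin (hyp_topology e) K \<longleftrightarrow> K \<subseteq> H \<and> compact K"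
  by (auto simp: hyp_topology_eq compactin_subtopology)

section \<open>Geodesics\<close>

lemma line_in_hyp:
  assumes "x \<in> H" "B x u = 0" "B u u = -1"
  shows "cosh t *\<^sub>R x + sinh t *\<^sub>R u \<in> H"
proof (rule in_hypI[OF assms(1)])
  show "B (cosh t *\<^sub>R x + sinh t *\<^sub>R u) (cosh t *\<^sub>R x + sinh t *\<^sub>R u) = 1"
    using assms hyperbolic_pythagoras[of t]
    by (simp add: form_linear form_self form_commute[of u x] power2_eq_square)
  show "B (cosh t *\<^sub>R x + sinh t *\<^sub>R u) x > 0"
    using assms by (simp add: form_linear form_self form_commute[of u x])
qed

lemma dist_line:
  assumes "x \<in> H" "B x u = 0" "B u u = -1"
  shows "d (cosh s *\<^sub>R x + sinh s *\<^sub>R u) (cosh t *\<^sub>R x + sinh t *\<^sub>R u) = \<bar>s - t\<bar>"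
  using assms
  by (intro dist_eqI line_in_hyp)
    (simp_all add: form_linear form_self form_commute[of u x] cosh_diff)

lemma direction_between:
  assumes "x \<in> H" "y \<in> H" "x \<noteq> y"
  obtains u where "B x u = 0" "B u u = -1" "y = cosh (d x y) *\<^sub>R x + sinh (d x y) *\<^sub>R u"
proof
  define a where "a = d x y"
  define u where "u = (1 / sinh a) *\<^sub>R (y - cosh a *\<^sub>R x)"
  have a: "sinh a > 0" "cosh a = B x y"
    using assms hyp.mdist_pos_less[of x y] by (auto simp: a_def cosh_dist)
  show "B x u = 0"
    using assms a by (simp add: u_def form_linear form_self)
  have "B (y - cosh a *\<^sub>R x) (y - cosh a *\<^sub>R x) = - (sinh a)\<^sup>2"
    unfolding sinh_square_eq a(2)
    using assms by (simp add: form_linear form_self form_commute[of y x] power2_eq_square)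
  then show "B u u = -1"
    using a by (simp only: u_def form_linear(5,6)) (simp add: power2_eq_square)
  show "y = cosh (d x y) *\<^sub>R x + sinh (d x y) *\<^sub>R u"
    using a unfolding u_def a_def[symmetric] by simp
qed

lemma geodesic_line:
  assumes "x \<in> H" "B x u = 0" "B u u = -1" "y = cosh (d x y) *\<^sub>R x + sinh (d x y) *\<^sub>R u"
  shows "hyp_geodesic e x y (\<lambda>t. cosh t *\<^sub>R x + sinh t *\<^sub>R u)"
  using line_in_hyp[OF assms(1-3)] dist_line[OF assms(1-3)] assms(4)
  unfolding hyp_geodesic_def by auto

text \<open>
  \<open>hyp_convex\<close> speaks about all isometrically parametrised segments.  The two distances of \<open>z\<close>
  fix its products with \<open>x\<close> and \<open>u\<close>, which gives the value 1 of the form at \<open>z\<close> and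
  the point of the standard segment, so the two points agree.
\<close>

lemma geodesic_unique:
  assumes "x \<in> H" "B x u = 0" "B u u = -1" "y = cosh L *\<^sub>R x + sinh L *\<^sub>R u" "L > 0"
    and z: "z \<in> H" "d x z = t" "d z y = L - t"
  shows "z = cosh t *\<^sub>R x + sinh t *\<^sub>R u"
proof (rule form_eq_1_imp_eq[OF z(1) line_in_hyp[OF assms(1-3)]])
  have y: "y \<in> H" unfolding assms(4) by (rule line_in_hyp[OF assms(1-3)])
  have "B z x = cosh t"
    using cosh_dist[OF assms(1) z(1)] z(2) by (simp add: form_commute)
  moreover have "B z y = cosh (L - t)"
    using cosh_dist[OF z(1) y] z(3) by simp
  ultimately have "sinh L * B z u = sinh L * (- sinh t)"
    unfolding assms(4) by (simp add: form_linear cosh_diff)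
  moreover have "sinh L \<noteq> 0" using assms(5) by simp
  ultimately have "B z u = - sinh t" using mult_left_cancel by blast
  then show "B z (cosh t *\<^sub>R x + sinh t *\<^sub>R u) = 1"
    using \<open>B z x = cosh t\<close> hyperbolic_pythagoras[of t]
    by (simp add: form_linear power2_eq_square)
qed

text \<open>
  The point at parameter \<open>t\<close> of a segment of length \<open>L\<close> as a combination of its endpoints.  The
  coefficients divided by \<open>sinh L\<close> have sum at most 1 by superadditivity of \<open>sinh\<close>, which makes
  balls convex.
\<close>

lemma sinh_scaled_line:
  "sinh L *\<^sub>R (cosh t *\<^sub>R x + sinh t *\<^sub>R u)
    = sinh (L - t) *\<^sub>R x + sinh t *\<^sub>R (cosh L *\<^sub>R x + sinh L *\<^sub>R u)" for L t :: real and x u :: 'a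
  by (simp add: sinh_diff algebra_simps)

lemma sinh_superadditive:
  fixes a b :: real
  assumes "a \<ge> 0" "b \<ge> 0"
  shows "sinh a + sinh b \<le> sinh (a + b)"
proof -
  have "sinh a * 1 \<le> sinh a * cosh b" "1 * sinh b \<le> cosh a * sinh b"
    by (intro mult_left_mono mult_right_mono cosh_real_ge_1; use assms in simp)+
  then show ?thesis by (simp add: sinh_add)
qed

lemma ball_intersection_convex:
  assumes "X \<subseteq> H"
  shows "hyp_convex e {z \<in> H. \<forall>x\<in>X. B x z \<le> C}"
  unfolding hyp_convex_def
proof (intro conjI ballI allI impI)
  fix x y g
  assume x: "x \<in> {z \<in> H. \<forall>x\<in>X. B x z \<le> C}" and y: "y \<in> {z \<in> H. \<forall>x\<in>X. B x z \<le> C}"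
    and g: "hyp_geodesic e x y g"
  define L where "L = d x y"
  show "g ` {0..d x y} \<subseteq> {z \<in> H. \<forall>x\<in>X. B x z \<le> C}"
  proof (rule image_subsetI)
    fix t assume t: "t \<in> {0..d x y}"
    have gt: "g t \<in> H" "d x (g t) = t" "d (g t) y = L - t"
    proof -
      have g': "g 0 = x" "g L = y" "g t \<in> H"
        "\<And>s t. s \<in> {0..L} \<Longrightarrow> t \<in> {0..L} \<Longrightarrow> d (g s) (g t) = \<bar>s - t\<bar>"
        using g t unfolding hyp_geodesic_def L_def by blast+
      show "g t \<in> H" "d x (g t) = t" "d (g t) y = L - t"
        using g'(3) g'(4)[of 0 t] g'(4)[of t L] t unfolding g'(1,2) by (auto simp: L_def)
    qed
    show "g t \<in> {z \<in> H. \<forall>x\<in>X. B x z \<le> C}"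
    proof (cases "x = y")
      case True
      then have "t = 0" using t x by simp
      then have "g t = x" using g unfolding hyp_geodesic_def by simp
      then show ?thesis using x by simp
    next
      case False
      obtain u where u: "B x u = 0" "B u u = -1" "y = cosh L *\<^sub>R x + sinh L *\<^sub>R u"
        using direction_between[of x y] x y False unfolding L_def by blast
      have L: "L > 0" using False x y by (simp add: L_def hyp.mdist_pos_less)
      have "g t = cosh t *\<^sub>R x + sinh t *\<^sub>R u"
        using geodesic_unique[OF _ u L gt] x by blast
      then have *: "sinh L *\<^sub>R g t = sinh (L - t) *\<^sub>R x + sinh t *\<^sub>R y"
        using sinh_scaled_line u(3) by metis
      have "B c (g t) \<le> C" if c: "c \<in> X" for c
      proof -
        have C: "B c x \<le> C" "B c y \<le> C" using x y c by auto
        moreover have "1 \<le> B c x" using x c assms by (intro form_ge_1) auto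
        ultimately have C0: "C \<ge> 0" by linarith
        have "sinh L * B c (g t) = sinh (L - t) * B c x + sinh t * B c y"
          using arg_cong[OF *, of "B c"] by (simp add: form_linear)
        also have "\<dots> \<le> sinh (L - t) * C + sinh t * C"
          using C t by (intro add_mono mult_left_mono) (auto simp: L_def)
        also have "\<dots> = (sinh (L - t) + sinh t) * C" by (simp add: algebra_simps)
        also have "\<dots> \<le> sinh L * C"
          using sinh_superadditive[of "L - t" t] t C0 by (intro mult_right_mono) (auto simp: L_def)
        finally show ?thesis using L by simp
      qed
      then show ?thesis using gt by simp
    qed
  qed
qed auto

text \<open>
  For a point \<open>z \<noteq> p\<close> of the hyperboloid the conclusion says that \<open>x\<close> lies beyond the hyperplane through \<open>p\<close> orthogonal to
  the segment from \<open>p\<close> to \<open>z\<close>.  It is the first order condition for \<open>B(\<cdot>, z)\<close> at \<open>p\<close> along the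
  geodesic from \<open>p\<close> to \<open>x\<close>.
\<close>

lemma nearest_point_halfspace:
  assumes K: "hyp_convex e K" and p: "p \<in> K" and near: "\<And>x. x \<in> K \<Longrightarrow> B p z \<le> B x z"
    and x: "x \<in> K"
  shows "B x p * B p z \<le> B x z"
proof (cases "x = p")
  case True
  then show ?thesis using K p by (auto simp: hyp_convex_def form_self)
next
  case False
  have KH: "K \<subseteq> H" using K by (simp add: hyp_convex_def)
  define L where "L = d p x"
  have L: "L > 0" unfolding L_def using False x p KH by (intro hyp.mdist_pos_less) auto
  obtain u where u: "B p u = 0" "B u u = -1" "x = cosh L *\<^sub>R p + sinh L *\<^sub>R u"
    using direction_between[of p x] x p KH False unfolding L_def by blast
  define f where "f t = cosh t * B p z + sinh t * B u z" for t
  have "B p z \<le> f t" if "0 \<le> t" "t \<le> L" for t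
  proof -
    have "hyp_geodesic e p x (\<lambda>t. cosh t *\<^sub>R p + sinh t *\<^sub>R u)"
      using geodesic_line[of p u x] u p KH unfolding L_def by blast
    then have "cosh t *\<^sub>R p + sinh t *\<^sub>R u \<in> K"
      using K p x that unfolding hyp_convex_def L_def
      by (metis (no_types, lifting) atLeastAtMost_iff image_subset_iff)
    from near[OF this] show ?thesis by (simp add: f_def form_linear)
  qed
  moreover have "(f has_real_derivative B u z) (at 0)"
    unfolding f_def by (auto intro!: derivative_eq_intros)
  moreover have "f 0 = B p z" by (simp add: f_def)
  ultimately have "B u z \<ge> 0"
    using DERIV_neg_dec_right[of f "B u z" 0] L
    by (metis add_0 field_lbound_gt_zero less_eq_real_def not_less)
  moreover have "B x z = cosh L * B p z + sinh L * B u z"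
    unfolding u(3) by (simp add: form_linear)
  moreover have "B x p = cosh L"
    using cosh_dist[OF subsetD[OF KH p] subsetD[OF KH x]] by (simp add: L_def form_commute[of x p])
  ultimately show ?thesis using L by simp
qed

section \<open>Horospheres\<close>

lemma isotropic_pos: "isotropic_vector e w \<Longrightarrow> w \<bullet> e > 0"
  by (simp add: isotropic_vector_def form_e)

lemma isotropic_null: "isotropic_vector e w \<Longrightarrow> B w w = 0"
  by (simp add: isotropic_vector_def)

lemma form_isotropic_pos: "isotropic_vector e w \<Longrightarrow> x \<in> H \<Longrightarrow> B x w > 0"
  using form_pos_timelike[of x w] isotropic_pos isotropic_null by (simp add: hyp_space_iff)

lemma horofunction_le:
  "isotropic_vector e w \<Longrightarrow> x \<in> H \<Longrightarrow> y \<in> H \<Longrightarrow> B x w \<le> exp (d x y) * B y w"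
  using form_le_exp_dist isotropic_pos isotropic_null by simp

text \<open>
  The geodesic through \<open>p\<close> with ideal endpoint \<open>span {w}\<close>, parametrised by arc length: \<open>w\<close> scaled to
  \<open>B(p, w) = 1\<close> is \<open>p\<close> plus the unit tangent vector at \<open>p\<close>.
\<close>

definition ray :: "'a \<Rightarrow> 'a \<Rightarrow> real \<Rightarrow> 'a" where
  "ray p w t = cosh t *\<^sub>R p + sinh t *\<^sub>R (w /\<^sub>R B p w - p)"

lemma
  assumes "isotropic_vector e w" "p \<in> H"
  shows ray_in_hyp: "ray p w t \<in> H"
    and dist_ray: "d p (ray p w t) = \<bar>t\<bar>"
    and form_ray: "B (ray p w t) w = exp (- t) * B p w"
proof -
  have s: "B p w > 0" using form_isotropic_pos assms by simp
  define v where "v = w /\<^sub>R B p w - p"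
  have v: "B p v = 0" "B v v = -1" "B v w = - B p w"
    using s assms isotropic_null[OF assms(1)]
    by (simp_all add: v_def form_linear form_self form_commute[of w p])
  show "ray p w t \<in> H"
    using line_in_hyp[OF assms(2) v(1,2)] by (simp add: ray_def v_def)
  show "d p (ray p w t) = \<bar>t\<bar>"
    using dist_line[OF assms(2) v(1,2), of 0 t] by (simp add: ray_def v_def)
  have "B (ray p w t) w = (cosh t - sinh t) * B p w"
    unfolding ray_def v_def[symmetric] by (simp add: form_linear v(3) algebra_simps)
  then show "B (ray p w t) w = exp (- t) * B p w"
    by (simp add: cosh_minus_sinh)
qed

text \<open>
  Points of the horosphere are not interior, since moving along the geodesic away from the ideal
  point increases the horofunction.
\<close>

lemma interior_horoball:
  assumes w: "isotropic_vector e w"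
  shows "hyp_topology e interior_of horoball e w r = {z \<in> H. B z w < r}"
proof
  show "hyp_topology e interior_of horoball e w r \<subseteq> {z \<in> H. B z w < r}"
  proof
    fix z assume "z \<in> hyp_topology e interior_of horoball e w r"
    then obtain U where U: "openin (hyp_topology e) U" "z \<in> U" "U \<subseteq> horoball e w r"
      by (auto simp: interior_of_def)
    then have z: "z \<in> H" by (auto simp: horoball_def)
    obtain a where a: "a > 0" "hyp.mball z a \<subseteq> U"
      using U unfolding hyp_topology_def hyp.openin_mtopology by blast
    have "ray z w (- (a/2)) \<in> hyp.mball z a"
      using ray_in_hyp[OF w z] dist_ray[OF w z] z a by simp
    then have "B (ray z w (- (a/2))) w \<le> r"
      using a U by (auto simp: horoball_def)
    then have "exp (a/2) * B z w \<le> r"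
      by (simp add: form_ray[OF w z])
    moreover have "1 * B z w < exp (a/2) * B z w"
      using a form_isotropic_pos[OF w z] by (intro mult_strict_right_mono) auto
    ultimately show "z \<in> {z \<in> H. B z w < r}" using z by simp
  qed
  have "open {z. B z w < r}"
    by (intro open_Collect_less continuous_intros)
  then have "openin (hyp_topology e) (H \<inter> {z. B z w < r})"
    unfolding hyp_topology_eq by (rule openin_open_Int)
  moreover have "H \<inter> {z. B z w < r} = {z \<in> H. B z w < r}" by blast
  ultimately show "{z \<in> H. B z w < r} \<subseteq> hyp_topology e interior_of horoball e w r"
    by (intro interior_of_maximal) (auto simp: horoball_def)
qed

lemma isotropic_same_span:
  assumes "isotropic_vector e w" "isotropic_vector e w'" "span {w} = span {w'}"
  obtains c where "c > 0" "w' = c *\<^sub>R w"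
proof -
  have "w' \<in> span {w}" using assms(3) by (simp add: span_base)
  then obtain c where c: "w' = c *\<^sub>R w" by (auto simp: span_singleton)
  then have "c > 0"
    using isotropic_pos[OF assms(1)] isotropic_pos[OF assms(2)] by (simp add: zero_less_mult_iff)
  with c that show thesis by blast
qed

lemma horo_width_eq:
  assumes w: "isotropic_vector e w" and K: "K \<subseteq> H" and ab: "a \<in> K" "b \<in> K"
    and ext: "\<And>x. x \<in> K \<Longrightarrow> B a w \<le> B x w \<and> B x w \<le> B b w"
  shows "horo_width e (span {w}) K = ln (B b w / B a w)"
  unfolding horo_width_def
proof (rule cInf_eq_minimum)
  have pos: "B a w > 0" "B b w > 0" using form_isotropic_pos[OF w] ab K by auto
  have "K \<subseteq> horoball e w (B b w) - hyp_topology e interior_of horoball e w (B a w)"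
    unfolding interior_horoball[OF w] unfolding horoball_def
    using K ext by (auto simp: not_less subset_iff)
  then show "ln (B b w / B a w) \<in> {ln (s / r) | w' r s. isotropic_vector e w' \<and>
      span {w} = span {w'} \<and> 0 < r \<and> r \<le> s \<and>
      K \<subseteq> horoball e w' s - hyp_topology e interior_of horoball e w' r}"
    using w pos ext[OF ab(1)] by blast
  fix l assume "l \<in> {ln (s / r) | w' r s. isotropic_vector e w' \<and>
      span {w} = span {w'} \<and> 0 < r \<and> r \<le> s \<and>
      K \<subseteq> horoball e w' s - hyp_topology e interior_of horoball e w' r}"
  then obtain w' r s where l: "l = ln (s / r)" and w': "isotropic_vector e w'" "span {w} = span {w'}"
    and rs: "0 < r" "r \<le> s"
    and sub: "K \<subseteq> horoball e w' s - hyp_topology e interior_of horoball e w' r"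
    by blast
  obtain c where c: "c > 0" "w' = c *\<^sub>R w" using isotropic_same_span[OF w w'] .
  have "b \<in> horoball e w' s" "a \<notin> hyp_topology e interior_of horoball e w' r"
    using sub ab by auto
  then have "c * B b w \<le> s" "r \<le> c * B a w"
    using ab K unfolding interior_horoball[OF w'(1)]
    by (auto simp: horoball_def c(2) form_linear)
  then have "(c * B b w) / (c * B a w) \<le> s / r"
    using rs pos c by (intro frac_le) auto
  then show "ln (B b w / B a w) \<le> l"
    unfolding l using c pos rs by (simp add: ln_mono)
qed

section \<open>Bounded sets and completeness\<close>

lemma bdd_above_dist:
  assumes "hyp_bounded e X"
  shows "bdd_above ((\<lambda>(x, y). d x y) ` (X \<times> X))"
proof -
  obtain b where "\<And>x y. x \<in> X \<Longrightarrow> y \<in> X \<Longrightarrow> d x y \<le> b"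
    using assms unfolding hyp_bounded_def hyp.mbounded_alt by blast
  then show ?thesis by (intro bdd_aboveI[of _ b]) auto
qed

lemma dist_le_diam:
  assumes "hyp_bounded e X" "x \<in> X" "y \<in> X"
  shows "d x y \<le> hyp_diam e X"
  using cSUP_upper[OF _ bdd_above_dist[OF assms(1)], of "(x, y)"] assms(2,3)
  by (auto simp: hyp_diam_def)

text \<open>
  Adding \<open>z\<close> enlarges the diameter exactly when some point of \<open>K\<close> is farther than \<open>D\<close> from \<open>z\<close>.
\<close>

lemma hyp_complete_iff:
  assumes K: "K \<subseteq> H" "hyp_bounded e K" and D: "hyp_diam e K = D" "D > 0"
  shows "hyp_complete e K \<longleftrightarrow> K = {z \<in> H. \<forall>x\<in>K. B x z \<le> cosh D}"
proof -
  have ne: "K \<noteq> {}" using D by (auto simp: hyp_diam_def)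
  have "hyp_diam e K < hyp_diam e (K \<union> {z}) \<longleftrightarrow> (\<exists>x\<in>K. d x z > D)" if z: "z \<in> H" for z
  proof
    assume "\<exists>x\<in>K. d x z > D"
    then obtain x where x: "x \<in> K" "d x z > D" by blast
    have "hyp_bounded e (K \<union> {z})"
      using K z unfolding hyp_bounded_def by (simp add: hyp.mbounded_Un hyp.mbounded_insert)
    from dist_le_diam[OF this, of x z] show "hyp_diam e K < hyp_diam e (K \<union> {z})"
      using x D by simp
  next
    assume less: "hyp_diam e K < hyp_diam e (K \<union> {z})"
    show "\<exists>x\<in>K. d x z > D"
    proof (rule ccontr)
      assume "\<not> (\<exists>x\<in>K. d x z > D)"
      then have *: "d x z \<le> D" "d z x \<le> D" if "x \<in> K" for x
        using that by (auto simp: hyp.commute not_less)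
      have "(SUP (x, y) \<in> (K \<union> {z}) \<times> (K \<union> {z}). d x y) \<le> D"
        by (rule cSUP_least) (use * dist_le_diam[OF K(2)] D z in auto)
      then have "hyp_diam e (K \<union> {z}) \<le> D" by (simp only: hyp_diam_def) simp
      with less D show False by simp
    qed
  qed
  moreover have "d x z > D \<longleftrightarrow> \<not> B x z \<le> cosh D" if "x \<in> K" "z \<in> H" for x z
    using dist_le_iff[of x z D] that K(1) D by auto
  moreover have "B x y \<le> cosh D" if "x \<in> K" "y \<in> K" for x y
    using dist_le_iff[of x y D] dist_le_diam[OF K(2) that] that K(1) D by auto
  ultimately show ?thesis
    using K unfolding hyp_complete_def by blast
qed

text \<open>
  Compactness can be checked in the ambient Euclidean space, where the distance from \<open>x0\<close> bounds
  the time coordinate and the time coordinate determines the norm.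
\<close>

lemma compact_ball_intersection:
  assumes "x0 \<in> X" "X \<subseteq> H" "D \<ge> 0"
  shows "compact {z \<in> H. \<forall>x\<in>X. B x z \<le> cosh D}" (is "compact ?S")
proof -
  have "?S = H \<inter> (\<Inter>x\<in>X. {z. B x z \<le> cosh D})" by auto
  also have "closed \<dots>"
    by (intro closed_Int closed_hyp closed_INT ballI closed_Collect_le continuous_intros)
  finally have "closed ?S" .
  moreover have "bounded ?S"
  proof -
    define c where "c = exp D * (x0 \<bullet> e)"
    have "norm z \<le> sqrt (2 * c\<^sup>2)" if "z \<in> ?S" for z
    proof (rule real_le_rsqrt)
      have x0: "x0 \<in> H" "z \<in> H" "x0 \<bullet> e > 0" "z \<bullet> e > 0"
        using assms that by (auto simp: hyp_space_iff)
      have "d z x0 \<le> D"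
        using that dist_le_iff[of x0 z D] assms x0 by (simp add: hyp.commute)
      then have "exp (d z x0) * (x0 \<bullet> e) \<le> c" using x0 by (simp add: c_def)
      then have "z \<bullet> e \<le> c"
        using form_le_exp_dist[of z x0 e] x0 by (simp add: form_e)
      then have "(z \<bullet> e)\<^sup>2 \<le> c\<^sup>2" using x0 by (simp add: power_mono)
      moreover have "(norm z)\<^sup>2 = 2 * (z \<bullet> e)\<^sup>2 - 1"
        using x0(2) unfolding power2_norm_eq_inner
        by (simp add: hyp_space_iff form_eq power2_eq_square)
      ultimately show "(norm z)\<^sup>2 \<le> 2 * c\<^sup>2" by simp
    qed
    then show ?thesis unfolding bounded_iff by blast
  qed
  ultimately show ?thesis by (simp add: compact_eq_bounded_closed)
qed

section \<open>Complete sets have constant width\<close>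

lemma form_convex_hull_le:
  assumes "m \<in> convex hull Q" "\<And>x. x \<in> Q \<Longrightarrow> B x y \<le> c"
  shows "B m y \<le> c"
proof -
  have "convex {z. B z y \<le> c}"
    by (intro convexI) (simp add: form_linear convex_bound_le)
  then have "convex hull Q \<subseteq> {z. B z y \<le> c}"
    using assms(2) by (intro hull_minimal) auto
  with assms(1) show ?thesis by blast
qed

lemma form_convex_hull_ge:
  assumes "m \<in> convex hull Q" "\<And>x. x \<in> Q \<Longrightarrow> c \<le> B x y"
  shows "c \<le> B m y"
  using form_convex_hull_le[OF assms(1), of "- y" "- c"] assms(2) by (simp add: form_linear)

text \<open>
  If \<open>B(a, x) > 0\<close> at every point \<open>x\<close> of \<open>K\<close> with \<open>B(p, x) = C\<close>, then by compactness \<open>p - t a\<close>,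
  scaled back to the hyperboloid, still satisfies all constraints \<open>B(x, \<cdot>) \<le> C\<close> for small \<open>t > 0\<close>.
  As \<open>a\<close> is spacelike, the scaling factor exceeds 1, so \<open>B(\<cdot>, w)\<close> strictly increases even when
  \<open>B(a, w) = 0\<close>, against the choice of \<open>p\<close>.
\<close>

lemma contact_point_blocks:
  assumes K: "compact K" "K \<subseteq> H" and complete: "K = {z \<in> H. \<forall>x\<in>K. B x z \<le> C}"
    and w: "isotropic_vector e w" and p: "p \<in> K" and max: "\<And>x. x \<in> K \<Longrightarrow> B x w \<le> B p w"
    and a: "a \<noteq> 0" "B a p = 0" "B a w \<le> 0"
  shows "\<exists>x\<in>K. B p x = C \<and> B a x \<le> 0"
proof (rule ccontr)
  assume "\<not> (\<exists>x\<in>K. B p x = C \<and> B a x \<le> 0)"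
  moreover have le: "B x y \<le> C" if "x \<in> K" "y \<in> K" for x y
    using complete that by blast
  ultimately have pos: "max (C - B p x) (B a x) > 0" if "x \<in> K" for x
    using that p unfolding less_max_iff_disj by (meson diff_gt_0_iff_gt not_le order_le_imp_less_or_eq)
  have ne: "K \<noteq> {}" using p by blast
  have pH: "p \<in> H" using K p by blast
  have C: "C \<ge> 1" using le[OF p p] by (simp add: form_self pH)
  define N where "N = - B a a"
  have N: "N > 0" using form_neg_orthogonal[OF pH a(2,1)] by (simp add: N_def)
  have "continuous_on K (\<lambda>x. max (C - B p x) (B a x))"
    by (intro continuous_intros)
  then obtain y0 where y0: "y0 \<in> K"
      "\<And>x. x \<in> K \<Longrightarrow> max (C - B p y0) (B a y0) \<le> max (C - B p x) (B a x)"
    using continuous_attains_inf[OF K(1) ne] by blast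
  \<comment> \<open>At every point of \<open>K\<close> the constraint has slack at least \<open>\<theta>\<close>, or it is relaxed at rate at least \<open>\<theta>\<close>.\<close>
  define \<theta> where "\<theta> = max (C - B p y0) (B a y0)"
  have \<theta>: "\<theta> > 0" "\<And>x. x \<in> K \<Longrightarrow> \<theta> \<le> C - B p x \<or> \<theta> \<le> B a x"
    unfolding le_max_iff_disj[symmetric] unfolding \<theta>_def by (rule pos[OF y0(1)], rule y0(2))
  have "continuous_on K (\<lambda>x. - B a x)" by (intro continuous_intros)
  then obtain y1 where y1: "y1 \<in> K" "\<And>x. x \<in> K \<Longrightarrow> - B a x \<le> - B a y1"
    using continuous_attains_sup[OF K(1) ne] by blast
  define M where "M = - B a y1"
  have M: "M \<ge> 0" "\<And>x. x \<in> K \<Longrightarrow> - B a x \<le> M"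
    using y1(2)[OF p] y1(2) by (simp_all add: M_def a(2))
  have CN: "C * N > 0" using C N by simp
  \<comment> \<open>This choice makes \<open>t M + t C N \<le> \<theta>\<close>, which covers the loss in both cases.\<close>
  define t where "t = min 1 (\<theta> / (M + C * N))"
  have t: "0 < t" "t \<le> 1" using \<theta> M CN by (simp_all add: t_def)
  have "t \<le> \<theta> / (M + C * N)" by (simp add: t_def)
  then have tt: "t * M + t * (C * N) \<le> \<theta>"
    using M CN by (simp add: pos_le_divide_eq algebra_simps)
  have tM: "0 \<le> t * M" using t M by simp
  have t2: "t * (t * (C * N)) \<le> t * (C * N)"
    using t CN by (intro mult_left_le_one_le) auto
  \<comment> \<open>\<open>k\<close> is the value of the form at \<open>p - t a\<close>.  The bound \<open>C k\<close> in \<open>key\<close> suffices because \<open>k \<le> sqrt k\<close>.\<close>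
  define k where "k = 1 - t\<^sup>2 * N"
  have Ck: "C * k = C - t * (t * (C * N))"
    by (simp add: k_def power2_eq_square algebra_simps)
  have key: "B p x - t * B a x \<le> C * k" if x: "x \<in> K" for x
  proof (cases "\<theta> \<le> C - B p x")
    case True
    have "t * (- B a x) \<le> t * M" using M(2)[OF x] t by (intro mult_left_mono) auto
    then show ?thesis using True tt t2 unfolding Ck by simp
  next
    case False
    then have "t * \<theta> \<le> t * B a x" using \<theta>(2)[OF x] t by (intro mult_left_mono) auto
    moreover have "t * (t * (C * N)) \<le> t * \<theta>" using tt tM t by (intro mult_left_mono) auto
    ultimately show ?thesis using le[OF p x] unfolding Ck by simp
  qed
  have "C * k > 0" using key[OF p] a(2) by (simp add: form_self pH)
  then have k: "k > 0" using C by (simp add: zero_less_mult_iff)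
  moreover have k1: "k < 1" using t N by (simp add: k_def)
  ultimately have sk: "sqrt k > 0" "sqrt k < 1" by simp_all
  define z where "z = (1 / sqrt k) *\<^sub>R (p - t *\<^sub>R a)"
  have "B (p - t *\<^sub>R a) (p - t *\<^sub>R a) = k"
    by (simp add: form_linear form_self pH a(2) form_commute[of p a] k_def N_def power2_eq_square)
  then have zz: "B z z = 1"
    using k by (simp only: z_def form_linear(5,6)) simp
  have "B z p > 0" using sk by (simp add: z_def form_linear form_self pH a(2))
  then have zH: "z \<in> H" using in_hypI[OF pH zz] by simp
  have "B x z \<le> C" if x: "x \<in> K" for x
  proof -
    have "B x z = (B p x - t * B a x) / sqrt k"
      by (simp add: z_def form_linear form_commute[of x p] form_commute[of x a])
    also have "\<dots> \<le> C * k / sqrt k" using key[OF x] sk by (intro divide_right_mono) auto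
    also have "\<dots> = C * sqrt k"
      using real_div_sqrt[of k] k by (simp only: times_divide_eq_right[symmetric])
    also have "\<dots> \<le> C * 1" using C sk by (intro mult_left_mono) auto
    finally show ?thesis by simp
  qed
  then have "z \<in> K" using zH complete by blast
  then have "B z w \<le> B p w" by (rule max)
  have pw: "B p w > 0" using form_isotropic_pos[OF w pH] .
  have "B p w < B p w / sqrt k" using pw sk by (simp add: less_divide_eq)
  also have "\<dots> \<le> (B p w - t * B a w) / sqrt k"
    using sk t a(3) by (intro divide_right_mono) (auto simp: mult_nonneg_nonpos)
  also have "\<dots> = B z w" by (simp add: z_def form_linear)
  finally show False using \<open>B z w \<le> B p w\<close> by simp
qed

text \<open>
  The set that a combination of constraint gradients must meet in the multiplier rule: with respect
  to the Lorentz form, \<open>w\<close> is the gradient of the function \<open>B(\<cdot>, w)\<close> to be maximised, and \<open>p\<close> is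
  normal to the hyperboloid at \<open>p\<close>, so its coefficient is unrestricted.
\<close>

definition ideal_half_plane :: "'a \<Rightarrow> 'a \<Rightarrow> 'a set" where
  "ideal_half_plane p w = {\<alpha> *\<^sub>R p + \<beta> *\<^sub>R w | \<alpha> \<beta>. \<beta> \<ge> 0}"

lemma convex_ideal_half_plane: "convex (ideal_half_plane p w)"
proof (rule convexI)
  fix x y u v assume xy: "x \<in> ideal_half_plane p w" "y \<in> ideal_half_plane p w"
    and uv: "(0::real) \<le> u" "0 \<le> v" "u + v = 1"
  obtain \<alpha> \<beta> \<alpha>' \<beta>' where *: "x = \<alpha> *\<^sub>R p + \<beta> *\<^sub>R w" "y = \<alpha>' *\<^sub>R p + \<beta>' *\<^sub>R w" "\<beta> \<ge> 0" "\<beta>' \<ge> 0"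
    using xy unfolding ideal_half_plane_def by blast
  have "u *\<^sub>R x + v *\<^sub>R y = (u * \<alpha> + v * \<alpha>') *\<^sub>R p + (u * \<beta> + v * \<beta>') *\<^sub>R w"
    by (simp add: * algebra_simps)
  moreover have "u * \<beta> + v * \<beta>' \<ge> 0" using * uv by simp
  ultimately show "u *\<^sub>R x + v *\<^sub>R y \<in> ideal_half_plane p w"
    unfolding ideal_half_plane_def by blast
qed

lemma closed_ideal_half_plane:
  assumes p: "p \<in> H" and w: "isotropic_vector e w"
  shows "closed (ideal_half_plane p w)"
proof -
  define s where "s = B p w"
  have s: "s > 0" using form_isotropic_pos[OF w p] by (simp add: s_def)
  \<comment> \<open>The coefficients of a point of the span of \<open>p\<close> and \<open>w\<close>, recovered from its products with \<open>w\<close> and \<open>p\<close>.\<close>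
  define \<alpha> where "\<alpha> z = B z w / s" for z
  define \<beta> where "\<beta> z = (B z p - \<alpha> z) / s" for z
  have "ideal_half_plane p w = {z. z = \<alpha> z *\<^sub>R p + \<beta> z *\<^sub>R w \<and> \<beta> z \<ge> 0}"
  proof -
    have "\<alpha> (a *\<^sub>R p + b *\<^sub>R w) = a" for a b
      using s by (simp add: \<alpha>_def s_def form_linear isotropic_null[OF w])
    moreover from this have "\<beta> (a *\<^sub>R p + b *\<^sub>R w) = b" for a b
      using s by (simp add: \<beta>_def form_linear form_self p form_commute[of w p] s_def)
    ultimately show ?thesis unfolding ideal_half_plane_def by auto
  qed
  also have "closed \<dots>"
    unfolding \<alpha>_def \<beta>_def using s
    by (intro closed_Collect_conj closed_Collect_eq closed_Collect_le continuous_intros) auto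
  finally show ?thesis .
qed

text \<open>
  The multiplier rule at the maximum \<open>p\<close>.  If the two convex sets were disjoint, the normal vector of
  a separating hyperplane would be orthogonal to \<open>p\<close>, since the half-plane contains the line spanned
  by \<open>p\<close>, and its dual \<open>a'\<close> with respect to the Lorentz form would contradict
  \<open>contact_point_blocks\<close>.
\<close>

lemma contact_hull_meets_half_plane:
  assumes K: "compact K" "K \<subseteq> H" and complete: "K = {z \<in> H. \<forall>x\<in>K. B x z \<le> C}"
    and w: "isotropic_vector e w" and p: "p \<in> K" and max: "\<And>x. x \<in> K \<Longrightarrow> B x w \<le> B p w"
  shows "convex hull {x \<in> K. B p x = C} \<inter> ideal_half_plane p w \<noteq> {}"
proof
  define Q where "Q = {x \<in> K. B p x = C}"
  assume "convex hull {x \<in> K. B p x = C} \<inter> ideal_half_plane p w = {}"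
  then have disj: "convex hull Q \<inter> ideal_half_plane p w = {}" by (simp add: Q_def)
  note blocks = contact_point_blocks[OF K complete w p max]
  have pH: "p \<in> H" using K p by blast
  have s: "B p w > 0" using form_isotropic_pos[OF w pH] .
  \<comment> \<open>There are contact points: otherwise nothing would stop \<open>p\<close> from moving away from the ideal point.\<close>
  define v where "v = w /\<^sub>R B p w - p"
  have v: "B v p = 0" "B v w = - B p w"
    using s by (simp_all add: v_def form_linear form_self pH form_commute[of w p] isotropic_null[OF w])
  then have "v \<noteq> 0" using s by (auto simp: form_linear)
  then have "Q \<noteq> {}" using blocks[of v] v s by (auto simp: Q_def)
  have "Q = K \<inter> {x. B p x = C}" by (auto simp: Q_def)
  also have "compact \<dots>"
    by (intro compact_Int_closed K closed_Collect_eq continuous_intros)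
  finally have "compact (convex hull Q)" by (rule compact_convex_hull)
  then obtain a b where ab: "\<And>x. x \<in> convex hull Q \<Longrightarrow> a \<bullet> x < b"
      "\<And>x. x \<in> ideal_half_plane p w \<Longrightarrow> b < a \<bullet> x"
    using separating_hyperplane_compact_closed[OF convex_convex_hull _ _ convex_ideal_half_plane
        closed_ideal_half_plane[OF pH w] disj] \<open>Q \<noteq> {}\<close>
    by (metis convex_hull_eq_empty)
  have plane: "b < \<alpha> * (a \<bullet> p) + \<beta> * (a \<bullet> w)" if "\<beta> \<ge> 0" for \<alpha> \<beta>
    using ab(2)[of "\<alpha> *\<^sub>R p + \<beta> *\<^sub>R w"] that by (auto simp: ideal_half_plane_def inner_simps)
  have b: "b < 0" using plane[of 0 0] by simp
  have ap: "a \<bullet> p = 0" using plane[of 0 "b / (a \<bullet> p)"] by (cases "a \<bullet> p = 0") auto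
  have aw: "a \<bullet> w \<ge> 0"
  proof (rule ccontr)
    assume "\<not> a \<bullet> w \<ge> 0"
    then show False using plane[of "b / (a \<bullet> w)" 0] b by (simp add: divide_nonpos_neg)
  qed
  \<comment> \<open>The reflection that turns the Euclidean inner product with \<open>- a\<close> into the Lorentz form.\<close>
  define a' where "a' = a - (2 * (a \<bullet> e)) *\<^sub>R e"
  have a': "B a' x = - (a \<bullet> x)" for x
    by (simp add: a'_def form_eq inner_simps inner_commute algebra_simps)
  have aQ: "B a' x > 0" if "x \<in> Q" for x
    using ab(1)[OF hull_inc[OF that]] b by (simp add: a')
  then have "a' \<noteq> 0" using \<open>Q \<noteq> {}\<close> by (force simp: form_linear)
  then obtain x where "x \<in> Q" "B a' x \<le> 0"
    using blocks[of a'] ap aw by (auto simp: a' Q_def)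
  with aQ show False by force
qed

text \<open>
  For \<open>m = \<alpha> p + \<beta> w\<close> in the convex hull of the contact points, \<open>B(m, p) = cosh D\<close> determines \<open>\<alpha>\<close>,
  and \<open>B(m, m) \<ge> 1\<close>, true for convex combinations of points of the hyperboloid, bounds \<open>\<beta> B(p, w)\<close> by
  \<open>sinh D\<close>.  So the point at distance \<open>D\<close> from \<open>p\<close> is \<open>\<kappa> m - (\<kappa> - 1) cosh D p\<close> with \<open>\<kappa> \<ge> 1\<close>.
\<close>

lemma opposite_point_in_complete:
  assumes K: "compact K" "K \<subseteq> H" and complete: "K = {z \<in> H. \<forall>x\<in>K. B x z \<le> cosh D}"
    and D: "D > 0" and y: "y \<in> K" "y \<noteq> p"
    and w: "isotropic_vector e w" and p: "p \<in> K" and max: "\<And>x. x \<in> K \<Longrightarrow> B x w \<le> B p w"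
  shows "ray p w D \<in> K"
proof -
  define C where "C = cosh D"
  define Q where "Q = {x \<in> K. B p x = C}"
  have pH: "p \<in> H" using K p by blast
  define s where "s = B p w"
  have s: "s > 0" using form_isotropic_pos[OF w pH] by (simp add: s_def)
  obtain m where m: "m \<in> convex hull Q" "m \<in> ideal_half_plane p w"
    using contact_hull_meets_half_plane[OF K complete w p max] unfolding Q_def C_def by blast
  then obtain \<alpha> \<beta> where m_eq: "m = \<alpha> *\<^sub>R p + \<beta> *\<^sub>R w" and "\<beta> \<ge> 0"
    unfolding ideal_half_plane_def by blast
  have mK: "B m x \<le> C" if "x \<in> K" for x
  proof (rule form_convex_hull_le[OF m(1)])
    fix q assume "q \<in> Q"
    then show "B q x \<le> C" using complete that unfolding Q_def C_def by blast
  qed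
  have Qp: "B q p = C" if "q \<in> Q" for q
    using that by (simp add: Q_def form_commute[of q p])
  have "B m p = C"
    using form_convex_hull_le[OF m(1), of p C] form_convex_hull_ge[OF m(1), of C p] Qp by simp
  then have \<alpha>: "\<alpha> = C - \<beta> * s"
    by (simp add: m_eq form_linear form_self pH form_commute[of w p] s_def)
  have QH: "Q \<subseteq> H" using K by (auto simp: Q_def)
  have "B m x \<ge> 1" if "x \<in> Q" for x
  proof (rule form_convex_hull_ge[OF m(1)])
    show "1 \<le> B q x" if "q \<in> Q" for q
      using \<open>x \<in> Q\<close> that QH by (intro form_ge_1) auto
  qed
  then have "B x m \<ge> 1" if "x \<in> Q" for x
    unfolding form_commute[of x m] using that .
  then have "B m m \<ge> 1" by (rule form_convex_hull_ge[OF m(1)])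
  moreover have "B m m = C\<^sup>2 - (\<beta> * s)\<^sup>2"
    by (simp add: m_eq \<alpha> form_linear form_self pH form_commute[of w p] s_def
        isotropic_null[OF w] power2_eq_square algebra_simps)
  ultimately have "(\<beta> * s)\<^sup>2 \<le> (sinh D)\<^sup>2"
    unfolding C_def sinh_square_eq by linarith
  moreover have "sinh D \<ge> 0" using D by simp
  ultimately have \<beta>s: "\<beta> * s \<le> sinh D" by (rule power2_le_imp_le)
  \<comment> \<open>If \<open>m = cosh D p\<close>, then \<open>B(m, y) \<le> cosh D\<close> would give \<open>y = p\<close>.\<close>
  have "\<beta> \<noteq> 0"
  proof
    assume "\<beta> = 0"
    then have "C * B p y \<le> C * 1" using mK[OF y(1)] by (simp add: m_eq \<alpha> form_linear)
    then have "B p y \<le> 1" using cosh_real_pos[of D] by (simp add: C_def)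
    moreover have "y \<in> H" using y(1) K by blast
    ultimately show False
      using form_ge_1[OF pH, of y] form_eq_1_imp_eq[OF pH, of y] y(2) by force
  qed
  then have pos: "\<beta> * s > 0" using \<open>\<beta> \<ge> 0\<close> s by simp
  define \<kappa> where "\<kappa> = sinh D / (\<beta> * s)"
  have \<kappa>: "\<kappa> \<ge> 1" "\<kappa> * (\<beta> * s) = sinh D" "\<kappa> * \<beta> = sinh D / s"
    using pos \<beta>s s \<open>\<beta> \<noteq> 0\<close> by (simp_all add: \<kappa>_def)
  have "\<kappa> *\<^sub>R m + (C * (1 - \<kappa>)) *\<^sub>R p = (C - \<kappa> * (\<beta> * s)) *\<^sub>R p + (\<kappa> * \<beta>) *\<^sub>R w"
    by (simp add: m_eq \<alpha> algebra_simps)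
  then have q: "ray p w D = \<kappa> *\<^sub>R m + (C * (1 - \<kappa>)) *\<^sub>R p"
    unfolding \<kappa>(2,3) by (simp add: ray_def C_def s_def divide_inverse algebra_simps)
  have "B x (ray p w D) \<le> C" if x: "x \<in> K" for x
  proof -
    have "B x (ray p w D) = \<kappa> * B m x - C * (\<kappa> - 1) * B p x"
      unfolding q by (simp add: form_linear form_commute[of x m] form_commute[of x p] algebra_simps)
    also have "\<dots> \<le> \<kappa> * C - C * (\<kappa> - 1) * 1"
      using \<kappa>(1) mK[OF x] form_ge_1[OF pH] x K(2) cosh_real_pos[of D]
      by (intro diff_mono mult_left_mono) (auto simp: C_def)
    finally show ?thesis by (simp add: algebra_simps)
  qed
  then show ?thesis
    using complete ray_in_hyp[OF w pH] unfolding C_def by blast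
qed

text \<open>
  The maximum of the horofunction on \<open>K\<close> is attained at \<open>p\<close>, and the Lipschitz bound shows that its
  minimum is attained at the point at distance \<open>D\<close> from \<open>p\<close> towards the ideal point.
\<close>

lemma complete_imp_constant_width:
  assumes K: "compact K" "K \<subseteq> H" and complete: "K = {z \<in> H. \<forall>x\<in>K. B x z \<le> cosh D}"
    and D: "D > 0" and two: "x \<in> K" "y \<in> K" "x \<noteq> y"
    and w: "isotropic_vector e w"
  shows "horo_width e (span {w}) K = D"
proof -
  have "continuous_on K (\<lambda>x. B x w)" by (intro continuous_intros)
  moreover have "K \<noteq> {}" using two by blast
  ultimately obtain p where p: "p \<in> K" "\<And>x. x \<in> K \<Longrightarrow> B x w \<le> B p w"
    using continuous_attains_sup[OF K(1)] by blast
  have pH: "p \<in> H" using K p by blast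
  define q where "q = ray p w D"
  obtain y' where "y' \<in> K" "y' \<noteq> p" using two by metis
  then have q: "q \<in> K"
    using opposite_point_in_complete[OF K complete D _ _ w p] unfolding q_def by blast
  have qw: "B q w = exp (- D) * B p w" unfolding q_def by (rule form_ray[OF w pH])
  have "B q w \<le> B x w" if x: "x \<in> K" for x
  proof -
    have xH: "x \<in> H" using x K by blast
    have "B x p \<le> cosh D" using complete x p(1) by blast
    then have "d p x \<le> D" using dist_le_iff[OF pH xH] D by (simp add: form_commute)
    then have "exp (d p x) * B x w \<le> exp D * B x w"
      using form_isotropic_pos[OF w xH] by (intro mult_right_mono) auto
    then have "B p w \<le> exp D * B x w" using horofunction_le[OF w pH xH] by simp
    then show ?thesis unfolding qw by (simp add: exp_minus field_simps)
  qed
  then have "horo_width e (span {w}) K = ln (B p w / B q w)"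
    using horo_width_eq[OF w K(2) q p(1)] p(2) by blast
  also have "B p w / B q w = exp D"
    using form_isotropic_pos[OF w pH] by (simp add: qw exp_minus field_simps)
  finally show ?thesis by simp
qed

section \<open>Convex sets of constant width are complete\<close>

text \<open>
  The horoball at the ideal endpoint of the ray from the nearest point \<open>p\<close> through \<open>z\<close> supports \<open>K\<close> at
  \<open>p\<close>, and a point of \<open>K\<close> on the opposite supporting horosphere is too far from \<open>z\<close>.
\<close>

lemma constant_width_imp_complete:
  assumes K: "compact K" "hyp_convex e K" "K \<noteq> {}" and D: "D > 0"
    and width: "\<And>w. isotropic_vector e w \<Longrightarrow> horo_width e (span {w}) K = D"
    and z: "z \<in> H" "\<And>x. x \<in> K \<Longrightarrow> B x z \<le> cosh D"
  shows "z \<in> K"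
proof (rule ccontr)
  assume "z \<notin> K"
  have KH: "K \<subseteq> H" using K(2) by (simp add: hyp_convex_def)
  have "continuous_on K (\<lambda>x. B x z)" by (intro continuous_intros)
  then obtain p where p: "p \<in> K" "\<And>x. x \<in> K \<Longrightarrow> B p z \<le> B x z"
    using continuous_attains_inf[OF K(1,3)] by blast
  have pH: "p \<in> H" and pz: "p \<noteq> z" using p(1) KH \<open>z \<notin> K\<close> by auto
  define a where "a = d p z"
  have a: "a > 0" unfolding a_def using pH z(1) pz by (rule hyp.mdist_pos_less[rotated])
  obtain u where u: "B p u = 0" "B u u = -1" "z = cosh a *\<^sub>R p + sinh a *\<^sub>R u"
    using direction_between[OF pH z(1) pz] unfolding a_def by blast
  \<comment> \<open>The null vector of the ideal endpoint of the ray from \<open>p\<close> through \<open>z\<close>.\<close>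
  define w where "w = p + u"
  have pw: "B p w = 1" and ww: "B w w = 0"
    using u by (simp_all add: w_def form_linear form_self pH form_commute[of u p])
  have "w \<bullet> e > 0"
  proof (rule ccontr)
    assume "\<not> w \<bullet> e > 0"
    have "B p (- w) \<ge> 0"
      by (rule form_nonneg_causal) (use pH ww \<open>\<not> w \<bullet> e > 0\<close> in \<open>simp_all add: hyp_space_iff form_linear\<close>)
    then show False by (simp add: pw form_linear)
  qed
  then have w: "isotropic_vector e w" using ww by (simp add: isotropic_vector_def form_e)
  have min: "B p w \<le> B x w" if x: "x \<in> K" for x
  proof -
    have xH: "x \<in> H" using x KH by blast
    have "B p z = cosh a" using cosh_dist[OF pH z(1)] by (simp add: a_def)
    then have "B x p * cosh a \<le> B x z"
      using nearest_point_halfspace[OF K(2) p x] by simp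
    moreover have "B x z = B x p * cosh a + sinh a * B x u"
      unfolding u(3) by (simp add: form_linear)
    ultimately have "B x u \<ge> 0" using a by (simp add: zero_le_mult_iff)
    then show ?thesis using form_ge_1[OF xH pH] unfolding pw by (simp add: w_def form_linear)
  qed
  have "continuous_on K (\<lambda>x. B x w)" by (intro continuous_intros)
  then obtain b where b: "b \<in> K" "\<And>x. x \<in> K \<Longrightarrow> B x w \<le> B b w"
    using continuous_attains_sup[OF K(1,3)] by blast
  have bH: "b \<in> H" using b KH by blast
  have "ln (B b w) = D"
    using horo_width_eq[OF w KH p(1) b(1)] min b(2) width[OF w] by (simp add: pw)
  then have bw: "B b w = exp D" using form_isotropic_pos[OF w bH] by (metis exp_ln)
  have "B z w = cosh a - sinh a"
    unfolding u(3) w_def using u by (simp add: form_linear form_self pH form_commute[of u p])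
  then have zw: "B z w = exp (- a)" by (simp add: cosh_minus_sinh)
  have "d b z \<le> D" using dist_le_iff[OF bH z(1)] z(2)[OF b(1)] D by simp
  then have "exp (d b z) * exp (- a) < exp D"
    using a unfolding exp_add[symmetric] by simp
  then show False
    using horofunction_le[OF w bH z(1)] unfolding bw zw by simp
qed

end

theorem theorem1p1:
  fixes n :: nat and e :: "'a::euclidean_space" and D :: real and K :: "'a set"
  assumes "n \<ge> 2" and "DIM('a) = n + 1" and "norm e = 1"
    and "D > 0"
    and "K \<subseteq> hyp_space e" and "hyp_bounded e K" and "hyp_diam e K = D"
  shows "hyp_complete e K \<longleftrightarrow>
           compactin (hyp_topology e) K \<and> hyp_convex e K \<and>
           (\<forall>i \<in> ideal_points e. horo_width e i K = D)"
proof -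
  interpret hyperboloid e using assms(3) by unfold_locales
  note K = assms(5) and bdd = assms(6) and diam = assms(7) and D = assms(4)
  have complete_iff: "hyp_complete e K \<longleftrightarrow> K = {z \<in> H. \<forall>x\<in>K. B x z \<le> cosh D}"
    by (rule hyp_complete_iff[OF K bdd diam D])
  have ne: "K \<noteq> {}" using diam D by (auto simp: hyp_diam_def)
  then obtain x where x: "x \<in> K" by blast
  have "\<not> K \<subseteq> {x}"
  proof
    assume "K \<subseteq> {x}"
    then have "K = {x}" using x by blast
    then have "hyp_diam e K = 0" using K by (simp add: hyp_diam_def)
    with diam D show False by simp
  qed
  then obtain y where y: "y \<in> K" "x \<noteq> y" by blast
  show ?thesis
  proof
    assume "hyp_complete e K"
    then have complete: "K = {z \<in> H. \<forall>x\<in>K. B x z \<le> cosh D}" using complete_iff by blast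
    have "compact K"
      by (subst complete) (rule compact_ball_intersection[OF x K less_imp_le[OF D]])
    moreover have "hyp_convex e K"
      by (subst complete) (rule ball_intersection_convex[OF K])
    ultimately show "compactin (hyp_topology e) K \<and> hyp_convex e K \<and>
           (\<forall>i \<in> ideal_points e. horo_width e i K = D)"
      using complete_imp_constant_width[OF _ K complete D x y] K
      by (auto simp: compactin_hyp_iff ideal_points_def)
  next
    assume R: "compactin (hyp_topology e) K \<and> hyp_convex e K \<and>
           (\<forall>i \<in> ideal_points e. horo_width e i K = D)"
    have "B x y \<le> cosh D" if "x \<in> K" "y \<in> K" for x y
      using dist_le_iff[of x y D] dist_le_diam[OF bdd that] that K D diam by auto
    moreover have "z \<in> K" if "z \<in> H" "\<forall>x\<in>K. B x z \<le> cosh D" for z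
      using R that by (intro constant_width_imp_complete[OF _ _ ne D _ that(1)])
        (auto simp: compactin_hyp_iff ideal_points_def)
    ultimately show "hyp_complete e K"
      unfolding complete_iff using K by blast
  qed
qed

end
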